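(* Let $\alpha_0,\lambda_0\in\mathbb R$ and let $u\in\mathcal S(\mathbb R)$ satisfy $\|u\|_{L^2(\mathbb R)}=1$, $u(x)=0$ if and only if $x=\lambda_0$, and $1+\alpha_0\gamma(|u|^2,\lambda_0)=0$. For each fixed $h\in\mathbb R$, $$\lim_{\alpha\to\alpha_0}\kappa(\alpha)\,\xi_\alpha'(\lambda_h(\alpha))=-\frac{1}{\pi(h^2+1)} .$$
   Context: For $f\in\mathcal S(\mathbb R)$, $\lambda\in\mathbb R$, $\gamma(f,\lambda)=\lim_{\epsilon\to0^+}\int_{|x-\lambda|\ge\epsilon}\frac{f(x)}{x-\lambda}\,dx$ (Cauchy principal value). Put $F_1(\alpha,\lambda)=1+\alpha\gamma(|u|^2,\lambda)$, $F_2(\alpha,\lambda)=\alpha\pi|u(\lambda)|^2$, $F=F_1+iF_2$. For $\alpha\ne\alpha_0$, $F(\alpha,\cdot)$ never vanishes. The function $\phi$ is defined by $\phi(x)=u(x)/(x-\lambda_0)$ for $x\ne\lambda_0$ and $\phi(\lambda_0)=u'(\lambda_0)$. Let $J$ be an open interval around $\alpha_0$ and $\lambda:J\to\mathbb R$, $\alpha\mapsto\lambda(\alpha)$, a $C^1$ function with $\lambda(\alpha_0)=\lambda_0$ and $F_1(\alpha,\lambda(\alpha))=0$ for $\alpha\in J$ (these exist by the implicit function theorem). For $\alpha\in J$, $h\in\mathbb R$ set $\kappa(\alpha)=\pi|u(\lambda(\alpha))|^2/\|\phi\|^2$ and $\lambda_h(\alpha)=\lambda(\alpha)+h\kappa(\alpha)$.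 For $\alpha\ne\alpha_0$, $\xi_\alpha(x)=\frac1\pi\arg F(\alpha,x)$, with $\arg$ the principal branch of the argument; this is Krein's spectral shift function for the pair $(H_0,H_\alpha)$ with $H_\alpha=M_x+\alpha\langle\cdot,u\rangle u$ on $L^2(\mathbb R)$, $M_x$ being multiplication by $x$ and $H_0=M_x$. The prime denotes the derivative in $x$, which exists at $\lambda_h(\alpha)$ for $\alpha\ne\alpha_0$ near $\alpha_0$. Limits $\alpha\to\alpha_0$ are over $\alpha\ne\alpha_0$. *)

theory Defs
  imports "HOL-Analysis.Analysis"
begin

definition iter_deriv :: "nat \<Rightarrow> (real \<Rightarrow> 'a::real_normed_vector) \<Rightarrow> real \<Rightarrow> 'a" where
  "iter_deriv n f = ((\<lambda>g x. vector_derivative g (at x)) ^^ n) f"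

definition schwartz_space :: "(real \<Rightarrow> 'a::real_normed_vector) set" where
  "schwartz_space =
     {f. (\<forall>n x. iter_deriv n f differentiable at x) \<and>
         (\<forall>k n. bounded (range (\<lambda>x. x ^ k *\<^sub>R iter_deriv n f x)))}"

text \<open>
  For square-integrable \<open>f\<close> only: the Bochner integral of a non-integrable function is \<open>0\<close>.
\<close>

definition L2_norm :: "(real \<Rightarrow> 'a::real_normed_vector) \<Rightarrow> real" where
  "L2_norm f = sqrt (LINT x|lborel. (norm (f x))\<^sup>2)"

text \<open>
  The principal value is generic in the codomain, so that for the real-valued function
  \<open>\<lambda>x. (cmod (u x))\<^sup>2\<close> it is a real number. As for any \<open>Lim\<close>, the value is meaningful
  only if the limit exists, which is the case for Schwartz functions.
\<close>

definition pv_integral ::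
  "(real \<Rightarrow> 'a::{banach,second_countable_topology}) \<Rightarrow> real \<Rightarrow> 'a" where
  "pv_integral f l =
     Lim (at_right 0) (\<lambda>\<epsilon>. LINT x:{x. \<epsilon> \<le> \<bar>x - l\<bar>}|lborel. f x /\<^sub>R (x - l))"

definition F1 :: "(real \<Rightarrow> complex) \<Rightarrow> real \<Rightarrow> real \<Rightarrow> real" where
  "F1 u \<alpha> l = 1 + \<alpha> * pv_integral (\<lambda>x. (cmod (u x))\<^sup>2) l"

definition F2 :: "(real \<Rightarrow> complex) \<Rightarrow> real \<Rightarrow> real \<Rightarrow> real" where
  "F2 u \<alpha> l = \<alpha> * pi * (cmod (u l))\<^sup>2"

definition F :: "(real \<Rightarrow> complex) \<Rightarrow> real \<Rightarrow> real \<Rightarrow> complex" where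
  "F u \<alpha> l = of_real (F1 u \<alpha> l) + \<i> * of_real (F2 u \<alpha> l)"

text \<open>
  For \<open>\<alpha> \<noteq> \<alpha>\<^sub>0\<close> this is Krein's spectral shift function of the pair of the multiplication
  operator \<open>M\<^sub>x\<close> and \<open>M\<^sub>x + \<alpha>\<langle>\<cdot>, u\<rangle>u\<close> on \<open>L\<^sup>2(\<real>)\<close>.
\<close>

definition xi :: "(real \<Rightarrow> complex) \<Rightarrow> real \<Rightarrow> real \<Rightarrow> real" where
  "xi u \<alpha> x = Arg (F u \<alpha> x) / pi"

definition phi :: "(real \<Rightarrow> complex) \<Rightarrow> real \<Rightarrow> real \<Rightarrow> complex" where
  "phi u l\<^sub>0 x =
     (if x = l\<^sub>0 then vector_derivative u (at l\<^sub>0) else u x / of_real (x - l\<^sub>0))"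

text \<open>In the next two definitions \<open>lam\<close> is the curve \<open>\<alpha> \<mapsto> \<lambda>(\<alpha>)\<close> of zeros of \<open>F1 u\<close>.\<close>

definition kappa :: "(real \<Rightarrow> complex) \<Rightarrow> real \<Rightarrow> (real \<Rightarrow> real) \<Rightarrow> real \<Rightarrow> real" where
  "kappa u l\<^sub>0 lam \<alpha> = pi * (cmod (u (lam \<alpha>)))\<^sup>2 / (L2_norm (phi u l\<^sub>0))\<^sup>2"

definition lam_shift ::
  "(real \<Rightarrow> complex) \<Rightarrow> real \<Rightarrow> (real \<Rightarrow> real) \<Rightarrow> real \<Rightarrow> real \<Rightarrow> real" where
  "lam_shift u l\<^sub>0 lam h \<alpha> = lam \<alpha> + h * kappa u l\<^sub>0 lam \<alpha>"

end

theory Submission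
  imports Defs "HOL-Probability.Sinc_Integral"
begin

text \<open>
  Write \<open>g = |u|\<^sup>2\<close>. The principal value \<open>\<gamma>(l)\<close> equals the absolutely convergent integral of
  \<open>(g(l + t) - g(l - t)) / t\<close> over \<open>t > 0\<close>, so dominated convergence shows that \<open>\<gamma>\<close> is
  continuously differentiable and that \<open>\<gamma>'\<close> is the same transform of \<open>g'\<close>. Since \<open>g\<close> has a
  double zero at \<open>\<lambda>\<^sub>0\<close>, an integration by parts gives \<open>\<gamma>'(\<lambda>\<^sub>0) = N\<close> with
  \<open>N = \<parallel>\<phi>\<parallel>\<^sup>2 > 0\<close>. Hence at \<open>\<lambda>\<^sub>h(\<alpha>)\<close> one has \<open>F\<^sub>1 / \<kappa> \<rightarrow> h \<alpha>\<^sub>0 N\<close>, \<open>F\<^sub>2 / \<kappa> \<rightarrow> \<alpha>\<^sub>0 N\<close>,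
  \<open>F\<^sub>1' \<rightarrow> \<alpha>\<^sub>0 N\<close> and \<open>F\<^sub>2' \<rightarrow> 0\<close>, and the limit follows from
  \<open>\<pi> \<xi>' = (F\<^sub>1 F\<^sub>2' - F\<^sub>2 F\<^sub>1') / (F\<^sub>1\<^sup>2 + F\<^sub>2\<^sup>2)\<close>.
\<close>

section \<open>Lebesgue integrals on the real line\<close>

text \<open>Limits along a real parameter can be tested on sequences, which reduces the claim to the
  sequential dominated convergence theorem.\<close>

lemma integral_dominated_convergence_at_within:
  fixes s :: "real \<Rightarrow> 'a \<Rightarrow> real" and w f :: "'a \<Rightarrow> real"
  assumes "f \<in> borel_measurable M" "\<And>y. s y \<in> borel_measurable M" "integrable M w"
    and lim: "\<And>x. ((\<lambda>y. s y x) \<longlongrightarrow> f x) (at a within S)"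
    and bound: "\<forall>\<^sub>F y in at a within S. \<forall>x. \<bar>s y x\<bar> \<le> w x"
  shows "((\<lambda>y. integral\<^sup>L M (s y)) \<longlongrightarrow> integral\<^sup>L M f) (at a within S)"
  unfolding tendsto_at_iff_sequentially
proof (intro allI impI)
  fix X :: "nat \<Rightarrow> real"
  assume X: "\<forall>i. X i \<in> S - {a}" "X \<longlonglongrightarrow> a"
  then have fX: "filterlim X (at a within S) sequentially"
    by (auto simp: filterlim_at)
  obtain N where N: "\<And>n x. N \<le> n \<Longrightarrow> \<bar>s (X n) x\<bar> \<le> w x"
    using filterlim_iff[THEN iffD1, OF fX, rule_format, OF bound]
    by (auto simp: eventually_sequentially)
  \<comment> \<open>Domination along \<open>X\<close> is only known from index \<open>N\<close> on,
    but the sequential theorem wants it at every index; hence the shift by \<open>N\<close>.\<close>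
  have "(\<lambda>n. integral\<^sup>L M (s (X (n + N)))) \<longlonglongrightarrow> integral\<^sup>L M f"
  proof (rule integral_dominated_convergence)
    show "AE x in M. (\<lambda>n. s (X (n + N)) x) \<longlonglongrightarrow> f x"
      by (intro AE_I2 LIMSEQ_ignore_initial_segment filterlim_compose[OF lim fX])
    show "AE x in M. norm (s (X (n + N)) x) \<le> w x" for n
      using N by auto
  qed (use assms in auto)
  then show "((\<lambda>y. integral\<^sup>L M (s y)) \<circ> X) \<longlonglongrightarrow> integral\<^sup>L M f"
    using LIMSEQ_offset[where k = N] by (simp add: comp_def)
qed

text \<open>The point 0 is null and the negative half-line is reflected onto the positive one. With
  the variable centred at \<open>l\<close>, this pairs \<open>l + t\<close> with
  \<open>l - t\<close>.\<close>

lemma integral_lborel_fold: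
  fixes k :: "real \<Rightarrow> real"
  assumes "integrable lborel k"
  shows "integral\<^sup>L lborel k = (LINT t:{0<..}|lborel. k t + k (- t))"
proof -
  have km [measurable]: "k \<in> borel_measurable borel"
    using assms by auto
  have int_refl: "integrable lborel (\<lambda>t. k (- t))"
    using lborel_integrable_real_affine[OF assms, of "-1" 0] by simp
  have ip: "integrable lborel (\<lambda>t. indicator {0<..} t * k t)"
    using integrable_real_mult_indicator[OF _ assms, of "{0<..}"] by (simp add: mult.commute)
  have im: "integrable lborel (\<lambda>t. indicator {..<0} t * k t)"
    using integrable_real_mult_indicator[OF _ assms, of "{..<0}"] by (simp add: mult.commute)
  have ir: "integrable lborel (\<lambda>t. indicator {0<..} t * k (- t))"
    using integrable_real_mult_indicator[OF _ int_refl, of "{0<..}"] by (simp add: mult.commute)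
  have "integral\<^sup>L lborel k
      = (\<integral>t. indicator {0<..} t * k t + indicator {..<0} t * k t \<partial>lborel)"
  proof (rule integral_cong_AE)
    show "AE t in lborel. k t = indicator {0<..} t * k t + indicator {..<0} t * k t"
      using AE_lborel_singleton[of 0] by eventually_elim (auto simp: indicator_def)
  qed auto
  also have "\<dots> = (\<integral>t. indicator {0<..} t * k t \<partial>lborel) + (\<integral>t. indicator {..<0} t * k t \<partial>lborel)"
    using ip im by (rule Bochner_Integration.integral_add)
  also have "(\<integral>t. indicator {..<0} t * k t \<partial>lborel)
      = (\<integral>t. indicator {..<0} (- t) * k (- t) \<partial>lborel)"
    using lborel_integral_real_affine[of "-1" "\<lambda>t. indicator {..<0} t * k t" 0] by simp
  also have "\<dots> = (\<integral>t. indicator {0<..} t * k (- t) \<partial>lborel)"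
    by (rule Bochner_Integration.integral_cong) (auto simp: indicator_def)
  finally show ?thesis
    using Bochner_Integration.integral_add[OF ip ir]
    by (simp add: set_lebesgue_integral_def distrib_left)
qed

text \<open>Every integrable majorant below has this shape.\<close>

lemma integrable_inverse_one_plus_square:
  "integrable lborel (\<lambda>t::real. c / (1 + t\<^sup>2))"
  using integrable_inverse_1_plus_square
  by (auto simp: set_integrable_def divide_inverse)

section \<open>Principal values of decaying functions\<close>

definition sym_quot :: "(real \<Rightarrow> real) \<Rightarrow> real \<Rightarrow> real \<Rightarrow> real" where
  "sym_quot f l t = (f (l + t) - f (l - t)) / t"

text \<open>Up to the factor -\<pi> this is the Hilbert transform of \<open>f\<close>, written as an
  ordinary integral.\<close>

definition sym_pv :: "(real \<Rightarrow> real) \<Rightarrow> real \<Rightarrow> real" where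
  "sym_pv f l = (LINT t:{0<..}|lborel. sym_quot f l t)"

text \<open>Quadratic decay controls the transform at infinity, a bounded derivative controls it at
  the singularity. Recording a single derivative lets the locale be instantiated for a function and
  again for its derivative.\<close>

locale decaying =
  fixes f f' :: "real \<Rightarrow> real" and C :: real
  assumes deriv: "(f has_real_derivative f' x) (at x)"
    and bound: "\<bar>f x\<bar> \<le> C / (1 + x\<^sup>2)"
    and bound_deriv: "\<bar>f' x\<bar> \<le> C"
begin

lemma C_nonneg: "0 \<le> C"
  using bound_deriv[of 0] by linarith

lemma cont: "continuous_on UNIV f"
  by (meson DERIV_isCont continuous_at_imp_continuous_on deriv)

lemma measurable_f [measurable]: "f \<in> borel_measurable borel"
  using cont by (rule borel_measurable_continuous_onI)

lemma measurable_sym_quot [measurable]: "sym_quot f l \<in> borel_measurable borel"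
  unfolding sym_quot_def by measurable

lemma lipschitz: "\<bar>f x - f y\<bar> \<le> C * \<bar>x - y\<bar>"
  using field_differentiable_bound[of UNIV f f' C x y] deriv bound_deriv by auto

lemma bound_le: "\<bar>f x\<bar> \<le> C"
proof -
  have "C / (1 + x\<^sup>2) \<le> C / 1"
    using C_nonneg by (intro divide_left_mono) (auto simp: add_pos_nonneg)
  then show ?thesis
    using bound[of x] by simp
qed

text \<open>Decay survives translation uniformly for centres \<open>l\<close> in a bounded set,
  which dominated convergence with a moving centre requires.\<close>

lemma bound_shift:
  assumes "\<bar>l\<bar> \<le> R"
  shows "\<bar>f (l + t)\<bar> \<le> 2 * C * (1 + R\<^sup>2) / (1 + t\<^sup>2)"
proof -
  have "l\<^sup>2 \<le> R\<^sup>2"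
    using assms by (metis abs_le_square_iff abs_of_nonneg abs_ge_zero order_trans)
  \<comment> \<open>The right side minus the left side is the square of
    \<open>t + 2 * l\<close>.\<close>
  moreover have "t\<^sup>2 \<le> 2 * (l + t)\<^sup>2 + 2 * l\<^sup>2"
    using zero_le_power2[of "t + 2 * l"] by (simp add: power2_eq_square algebra_simps)
  moreover have "0 \<le> R\<^sup>2 * (l + t)\<^sup>2"
    by simp
  ultimately have "1 + t\<^sup>2 \<le> 2 * (1 + R\<^sup>2) * (1 + (l + t)\<^sup>2)"
    by (simp only: distrib_left distrib_right)
  then have "C * (1 + t\<^sup>2) \<le> C * (2 * (1 + R\<^sup>2) * (1 + (l + t)\<^sup>2))"
    using C_nonneg by (rule mult_left_mono)
  then have "C \<le> 2 * C * (1 + R\<^sup>2) / (1 + t\<^sup>2) * (1 + (l + t)\<^sup>2)"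
    by (simp add: le_divide_eq add_pos_nonneg mult_ac)
  then have "C / (1 + (l + t)\<^sup>2) \<le> 2 * C * (1 + R\<^sup>2) / (1 + t\<^sup>2)"
    by (subst divide_le_eq) (simp add: add_pos_nonneg)
  then show ?thesis
    using bound[of "l + t"] by linarith
qed

text \<open>For small \<open>t\<close> the Lipschitz bound cancels the denominator; for
  \<open>t > 1\<close> the denominator only helps and both values of \<open>f\<close> decay. The
  factor 4 covers both cases.\<close>

lemma sym_quot_bound:
  assumes "\<bar>l\<bar> \<le> R" "0 < t"
  shows "\<bar>sym_quot f l t\<bar> \<le> 4 * C * (1 + R\<^sup>2) / (1 + t\<^sup>2)"
proof (cases "t \<le> 1")
  case True
  have "\<bar>f (l + t) - f (l - t)\<bar> \<le> C * (2 * t)"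
    using lipschitz[of "l + t" "l - t"] assms by simp
  then have "\<bar>sym_quot f l t\<bar> \<le> 2 * C"
    using assms by (simp add: sym_quot_def abs_divide divide_le_eq mult_ac)
  also have "\<dots> \<le> 4 * C * (1 + R\<^sup>2) / (1 + t\<^sup>2)"
  proof -
    have "t\<^sup>2 \<le> 1"
      using True assms by (simp add: power_le_one)
    then have "1 + t\<^sup>2 \<le> 2 * (1 + R\<^sup>2)"
      using zero_le_power2[of R] by (simp only: distrib_left)
    then have "2 * C * (1 + t\<^sup>2) \<le> 2 * C * (2 * (1 + R\<^sup>2))"
      using C_nonneg by (intro mult_left_mono) auto
    then show ?thesis
      by (simp add: le_divide_eq add_pos_nonneg mult_ac)
  qed
  finally show ?thesis .
next
  case False
  have "\<bar>f (l + t) - f (l - t)\<bar> \<le> 4 * C * (1 + R\<^sup>2) / (1 + t\<^sup>2)"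
    using bound_shift[OF assms(1), of t] bound_shift[OF assms(1), of "-t"]
    by (simp add: abs_le_iff)
  moreover have "\<bar>f (l + t) - f (l - t)\<bar> / t \<le> \<bar>f (l + t) - f (l - t)\<bar> / 1"
    using False by (intro divide_left_mono) (auto simp: add_pos_nonneg)
  ultimately show ?thesis
    using assms by (simp add: sym_quot_def abs_divide)
qed

lemma sym_pv_tendsto: "(sym_pv f \<longlongrightarrow> sym_pv f l) (at l)"
  unfolding sym_pv_def set_lebesgue_integral_def
proof (rule integral_dominated_convergence_at_within
    [where w = "\<lambda>t. 4 * C * (1 + (\<bar>l\<bar> + 1)\<^sup>2) / (1 + t\<^sup>2)"])
  have "isCont f x" for x
    using deriv by (rule DERIV_isCont)
  then show "((\<lambda>y. indicat_real {0<..} t *\<^sub>R sym_quot f y t)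
      \<longlongrightarrow> indicat_real {0<..} t *\<^sub>R sym_quot f l t) (at l)" for t
    unfolding sym_quot_def divide_inverse
    by (intro tendsto_intros isCont_tendsto_compose[of _ f])
  \<comment> \<open>Staying within distance 1 of \<open>l\<close> allows the majorant with
    \<open>R = \<bar>l\<bar> + 1\<close>, which is independent of \<open>y\<close>.\<close>
  have "\<forall>\<^sub>F y in at l. dist y l < 1"
    by (auto simp: eventually_at intro: exI[of _ 1])
  then show "\<forall>\<^sub>F y in at l. \<forall>t. \<bar>indicat_real {0<..} t *\<^sub>R sym_quot f y t\<bar>
      \<le> 4 * C * (1 + (\<bar>l\<bar> + 1)\<^sup>2) / (1 + t\<^sup>2)"
  proof eventually_elim
    case (elim y)
    then have "\<bar>y\<bar> \<le> \<bar>l\<bar> + 1"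
      by (auto simp: dist_real_def)
    from sym_quot_bound[OF this] show ?case
      using C_nonneg by (auto simp: indicator_def)
  qed
qed (auto intro: integrable_inverse_one_plus_square)

lemma sym_pv_integrable: "set_integrable lborel {0<..} (sym_quot f l)"
  unfolding set_integrable_def
proof (rule Bochner_Integration.integrable_bound
    [OF integrable_inverse_one_plus_square[of "4 * C * (1 + \<bar>l\<bar>\<^sup>2)"]])
  show "AE t in lborel. norm (indicator {0<..} t *\<^sub>R sym_quot f l t)
      \<le> norm (4 * C * (1 + \<bar>l\<bar>\<^sup>2) / (1 + t\<^sup>2))"
    using sym_quot_bound[OF order_refl, of _ l] C_nonneg
    by (auto simp: indicator_def abs_divide abs_mult)
qed auto

text \<open>
  Pairing the points \<open>l + t\<close> and \<open>l - t\<close> turns the principal value into an absolutely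
  convergent integral.
\<close>

lemma pv_integral_eq_sym_pv: "pv_integral f l = sym_pv f l"
proof -
  have trunc: "(LINT x:{x. \<epsilon> \<le> \<bar>x - l\<bar>}|lborel. f x /\<^sub>R (x - l))
      = (\<integral>t. indicator {\<epsilon>..} t * sym_quot f l t \<partial>lborel)" if "0 < \<epsilon>" for \<epsilon>
  proof -
    \<comment> \<open>This is the truncated integrand with its singularity moved to 0. The cut-off
      bounds the reciprocal of \<open>\<bar>t\<bar>\<close> by that of \<epsilon>, so
      \<open>k\<close> is integrable and can be folded.\<close>
    define k where "k t = indicat_real {t. \<epsilon> \<le> \<bar>t\<bar>} t * (f (l + t) / t)" for t
    have [measurable]: "k \<in> borel_measurable borel"
      unfolding k_def by measurable
    have "integrable lborel k"
    proof (rule Bochner_Integration.integrable_bound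
        [OF integrable_inverse_one_plus_square[of "2 * C * (1 + \<bar>l\<bar>\<^sup>2) / \<epsilon>"]])
      have "\<bar>k t\<bar> \<le> 2 * C * (1 + \<bar>l\<bar>\<^sup>2) / \<epsilon> / (1 + t\<^sup>2)" for t
      proof (cases "\<epsilon> \<le> \<bar>t\<bar>")
        case True
        then have "\<bar>k t\<bar> = \<bar>f (l + t)\<bar> / \<bar>t\<bar>"
          by (simp add: k_def abs_divide)
        also have "\<dots> \<le> \<bar>f (l + t)\<bar> / \<epsilon>"
          using True that by (intro divide_left_mono) (auto simp: add_pos_nonneg)
        also have "\<dots> \<le> 2 * C * (1 + \<bar>l\<bar>\<^sup>2) / (1 + t\<^sup>2) / \<epsilon>"
          using that by (intro divide_right_mono bound_shift) auto
        finally show ?thesis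
          by (simp add: field_simps)
      next
        case False
        then show ?thesis
          using C_nonneg that by (simp add: k_def)
      qed
      then show "AE t in lborel. norm (k t) \<le> norm (2 * C * (1 + \<bar>l\<bar>\<^sup>2) / \<epsilon> / (1 + t\<^sup>2))"
        by (intro AE_I2) (metis abs_ge_self order_trans real_norm_def)
    qed auto
    have "(LINT x:{x. \<epsilon> \<le> \<bar>x - l\<bar>}|lborel. f x /\<^sub>R (x - l)) = integral\<^sup>L lborel k"
      unfolding set_lebesgue_integral_def
      by (subst lborel_integral_real_affine[of 1 _ l])
        (simp_all add: k_def[abs_def] indicator_def divide_inverse mult.commute)
    also have "\<dots> = (LINT t:{0<..}|lborel. k t + k (- t))"
      using \<open>integrable lborel k\<close> by (rule integral_lborel_fold)
    also have "\<dots> = (\<integral>t. indicator {\<epsilon>..} t * sym_quot f l t \<partial>lborel)"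
      unfolding set_lebesgue_integral_def
    proof (rule Bochner_Integration.integral_cong[OF refl])
      \<comment> \<open>Reflection flips the sign of the denominator, turning the sum of the two
        values of \<open>k\<close> into the difference in \<open>sym_quot\<close>.\<close>
      show "indicat_real {0<..} t *\<^sub>R (k t + k (- t)) = indicator {\<epsilon>..} t * sym_quot f l t" for t
        using that by (cases "0 < t") (auto simp: k_def sym_quot_def indicator_def diff_divide_distrib)
    qed
    finally show ?thesis .
  qed
  have "((\<lambda>\<epsilon>. \<integral>t. indicator {\<epsilon>..} t * sym_quot f l t \<partial>lborel)
      \<longlongrightarrow> (\<integral>t. indicator {0<..} t * sym_quot f l t \<partial>lborel)) (at_right 0)"
  proof (rule integral_dominated_convergence_at_within
      [where w = "\<lambda>t. 4 * C * (1 + \<bar>l\<bar>\<^sup>2) / (1 + t\<^sup>2)"])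
    show "((\<lambda>\<epsilon>. indicator {\<epsilon>..} t * sym_quot f l t)
        \<longlongrightarrow> indicator {0<..} t * sym_quot f l t) (at_right 0)" for t
    proof (rule tendsto_eventually)
      \<comment> \<open>For fixed \<open>t\<close> the truncated integrand is eventually constant:
        \<epsilon> drops below \<open>t\<close> if \<open>t > 0\<close>, and otherwise both
        indicators vanish.\<close>
      show "\<forall>\<^sub>F \<epsilon> in at_right 0. indicator {\<epsilon>..} t * sym_quot f l t
          = indicator {0<..} t * sym_quot f l t"
      proof (cases "0 < t")
        case True
        then have "\<forall>\<^sub>F \<epsilon> in at_right 0. \<epsilon> < t"
          by (intro eventually_at_rightI[of 0 t]) auto
        then show ?thesis
          by eventually_elim (use True in \<open>auto simp: indicator_def\<close>)
      next
        case False
        show ?thesis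
          using eventually_at_right_less[of 0]
          by eventually_elim (use False in \<open>auto simp: indicator_def\<close>)
      qed
    qed
    show "\<forall>\<^sub>F \<epsilon> in at_right 0. \<forall>t. \<bar>indicator {\<epsilon>..} t * sym_quot f l t\<bar>
        \<le> 4 * C * (1 + \<bar>l\<bar>\<^sup>2) / (1 + t\<^sup>2)"
      using eventually_at_right_less[of 0]
    proof eventually_elim
      case (elim \<epsilon>)
      then show ?case
        using sym_quot_bound[OF order_refl, of _ l] C_nonneg by (auto simp: indicator_def)
    qed
  qed (auto intro: integrable_inverse_one_plus_square)
  then have "((\<lambda>\<epsilon>. \<integral>t. indicator {\<epsilon>..} t * sym_quot f l t \<partial>lborel) \<longlongrightarrow> sym_pv f l) (at_right 0)"
    by (simp add: sym_pv_def set_lebesgue_integral_def)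
  then have "((\<lambda>\<epsilon>. LINT x:{x. \<epsilon> \<le> \<bar>x - l\<bar>}|lborel. f x /\<^sub>R (x - l)) \<longlongrightarrow> sym_pv f l) (at_right 0)"
  proof (rule Lim_transform_eventually)
    show "\<forall>\<^sub>F \<epsilon> in at_right 0. (\<integral>t. indicator {\<epsilon>..} t * sym_quot f l t \<partial>lborel)
        = (LINT x:{x. \<epsilon> \<le> \<bar>x - l\<bar>}|lborel. f x /\<^sub>R (x - l))"
      using eventually_at_right_less[of 0] by eventually_elim (simp only: trunc)
  qed
  then show ?thesis
    unfolding pv_integral_def by (intro tendsto_Lim) auto
qed

end

text \<open>Differentiation under the integral sign: the difference quotients in the centre are
  dominated through the bound on \<open>sym_quot f'\<close>, which is why \<open>f'\<close> has to
  decay as well.\<close>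

lemma has_real_derivative_sym_pv:
  assumes "decaying f f' C" "decaying f' f'' D"
  shows "(sym_pv f has_real_derivative sym_pv f' l) (at l)"
proof -
  interpret f: decaying f f' C by fact
  interpret f': decaying f' f'' D by fact
  have quot_deriv: "((\<lambda>l. sym_quot f l t) has_real_derivative sym_quot f' l t) (at l)" for l t
    unfolding sym_quot_def
    using DERIV_shift[of f "f' (l + t)" l t] DERIV_shift[of f "f' (l - t)" l "-t"] f.deriv
    by (intro DERIV_cdivide DERIV_diff) auto
  have int: "integrable lborel (\<lambda>t. indicator {0<..} t * sym_quot f y t)" for y
    using f.sym_pv_integrable[of y] by (simp add: set_integrable_def)
  have eq: "(sym_pv f y - sym_pv f l) / (y - l)
      = (\<integral>t. indicator {0<..} t * ((sym_quot f y t - sym_quot f l t) / (y - l)) \<partial>lborel)" for y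
    unfolding sym_pv_def set_lebesgue_integral_def real_scaleR_def
    by (simp only: Bochner_Integration.integral_diff[OF int int, symmetric]
        integral_divide_zero[symmetric] right_diff_distrib[symmetric] times_divide_eq_right)
  have "((\<lambda>y. \<integral>t. indicator {0<..} t * ((sym_quot f y t - sym_quot f l t) / (y - l)) \<partial>lborel)
      \<longlongrightarrow> (\<integral>t. indicator {0<..} t * sym_quot f' l t \<partial>lborel)) (at l)"
  proof (rule integral_dominated_convergence_at_within
      [where w = "\<lambda>t. 4 * D * (1 + (\<bar>l\<bar> + 1)\<^sup>2) / (1 + t\<^sup>2)"])
    show "((\<lambda>y. indicator {0<..} t * ((sym_quot f y t - sym_quot f l t) / (y - l)))
        \<longlongrightarrow> indicator {0<..} t * sym_quot f' l t) (at l)" for t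
      using quot_deriv[of t l] by (intro tendsto_intros) (simp add: has_field_derivative_iff)
    have "\<forall>\<^sub>F y in at l. y \<noteq> l \<and> dist y l < 1"
      by (auto simp: eventually_at intro: exI[of _ 1])
    then show "\<forall>\<^sub>F y in at l. \<forall>t.
        \<bar>indicator {0<..} t * ((sym_quot f y t - sym_quot f l t) / (y - l))\<bar>
        \<le> 4 * D * (1 + (\<bar>l\<bar> + 1)\<^sup>2) / (1 + t\<^sup>2)"
    proof eventually_elim
      case (elim y)
      have "\<bar>(sym_quot f y t - sym_quot f l t) / (y - l)\<bar> \<le> 4 * D * (1 + (\<bar>l\<bar> + 1)\<^sup>2) / (1 + t\<^sup>2)"
        if "0 < t" for t
      proof -
        \<comment> \<open>The mean value inequality in the centre, on the unit ball around
          \<open>l\<close>, transfers the bound on \<open>sym_quot f'\<close> to increments of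
          \<open>sym_quot f\<close>.\<close>
        have "norm (sym_quot f y t - sym_quot f l t)
            \<le> 4 * D * (1 + (\<bar>l\<bar> + 1)\<^sup>2) / (1 + t\<^sup>2) * norm (y - l)"
        proof (rule field_differentiable_bound[where S = "cball l 1"])
          show "norm (sym_quot f' z t) \<le> 4 * D * (1 + (\<bar>l\<bar> + 1)\<^sup>2) / (1 + t\<^sup>2)"
            if "z \<in> cball l 1" for z
          proof -
            have "\<bar>z\<bar> \<le> \<bar>l\<bar> + 1"
              using that by (auto simp: dist_real_def)
            then show ?thesis
              using f'.sym_quot_bound \<open>0 < t\<close> by simp
          qed
        qed (use elim quot_deriv in \<open>auto intro: has_field_derivative_at_within simp: dist_commute\<close>)
        then show ?thesis
          using elim by (simp add: abs_divide divide_le_eq)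
      qed
      then show ?case
        using f'.C_nonneg by (auto simp: indicator_def)
    qed
  qed (auto intro: integrable_inverse_one_plus_square)
  then show ?thesis
    unfolding has_field_derivative_iff eq by (simp add: sym_pv_def set_lebesgue_integral_def)
qed

text \<open>Integration by parts on the folded half-line moves the derivative onto the kernel. The
  double zero makes the new integrand bounded near 0 and removes the boundary term there;
  boundedness of \<open>f\<close> removes the one at infinity.\<close>

lemma sym_pv_deriv_double_zero:
  assumes "decaying f f' C" "decaying f' f'' D" "f l = 0" "f' l = 0"
  shows "integrable lborel (\<lambda>t. f (l + t) / t\<^sup>2)"
    and "sym_pv f' l = (\<integral>t. f (l + t) / t\<^sup>2 \<partial>lborel)"
proof -
  interpret f: decaying f f' C by fact
  interpret f': decaying f' f'' D by fact
  \<comment> \<open>Since \<open>f' l = 0\<close> and \<open>f'\<close> is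
    \<open>D\<close>-Lipschitz, \<open>f'\<close> is at most \<open>D * \<bar>t\<bar>\<close> within
    distance \<open>\<bar>t\<bar>\<close> of \<open>l\<close>.\<close>
  have quad: "\<bar>f (l + t)\<bar> \<le> D * t\<^sup>2" for t
  proof -
    have "norm (f (l + t) - f l) \<le> D * \<bar>t\<bar> * norm (l + t - l)"
    proof (rule field_differentiable_bound[where S = "cball l \<bar>t\<bar>" and f' = f'])
      show "norm (f' z) \<le> D * \<bar>t\<bar>" if "z \<in> cball l \<bar>t\<bar>" for z
      proof -
        have "\<bar>f' z\<bar> \<le> D * \<bar>z - l\<bar>"
          using f'.lipschitz[of z l] assms by simp
        also have "\<dots> \<le> D * \<bar>t\<bar>"
          using that f'.C_nonneg by (intro mult_left_mono) (auto simp: dist_real_def)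
        finally show ?thesis by simp
      qed
    qed (auto intro: has_field_derivative_at_within f.deriv simp: dist_real_def)
    then show ?thesis
      using assms by (simp add: power2_eq_square mult.assoc)
  qed
  define k where "k t = f (l + t) / t\<^sup>2" for t
  have [measurable]: "k \<in> borel_measurable borel"
    unfolding k_def by measurable
  define B where "B = 2 * C * (1 + \<bar>l\<bar>\<^sup>2)"
  have "0 \<le> B"
    using f.C_nonneg by (simp add: B_def)
  \<comment> \<open>The summand \<open>2 * D\<close> serves \<open>\<bar>t\<bar> \<le> 1\<close>,
    where \<open>1 + t\<^sup>2 \<le> 2\<close>, and \<open>B\<close> serves the tail. At
    \<open>t = 0\<close> the quotient is 0 by the division convention.\<close>
  have k_bound: "\<bar>k t\<bar> \<le> (2 * D + B) / (1 + t\<^sup>2)" for t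
  proof (cases "t\<^sup>2 \<le> 1")
    case True
    have "\<bar>k t\<bar> \<le> D"
      using quad[of t] f'.C_nonneg by (cases "t = 0") (auto simp: k_def abs_divide divide_le_eq)
    also have "\<dots> \<le> (2 * D + B) / (1 + t\<^sup>2)"
    proof -
      have "D * (1 + t\<^sup>2) \<le> D * 2"
        using True f'.C_nonneg by (intro mult_left_mono) auto
      then have "D * (1 + t\<^sup>2) \<le> 2 * D + B"
        using \<open>0 \<le> B\<close> by simp
      then show ?thesis
        by (subst le_divide_eq) (simp add: add_pos_nonneg)
    qed
    finally show ?thesis .
  next
    case False
    have "\<bar>k t\<bar> \<le> \<bar>f (l + t)\<bar> / 1"
      unfolding k_def abs_divide using False by (intro divide_left_mono) auto
    also have "\<dots> \<le> B / (1 + t\<^sup>2)"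
      using f.bound_shift[of l "\<bar>l\<bar>" t] by (simp add: B_def)
    also have "\<dots> \<le> (2 * D + B) / (1 + t\<^sup>2)"
      using f'.C_nonneg by (intro divide_right_mono) auto
    finally show ?thesis .
  qed
  have k_int: "integrable lborel k"
  proof (rule Bochner_Integration.integrable_bound
      [OF integrable_inverse_one_plus_square[of "2 * D + B"]])
    show "AE t in lborel. norm (k t) \<le> norm ((2 * D + B) / (1 + t\<^sup>2))"
      using k_bound by (intro AE_I2) (metis abs_ge_self order_trans real_norm_def)
  qed auto
  then show "integrable lborel (\<lambda>t. f (l + t) / t\<^sup>2)"
    by (simp add: k_def[abs_def])
  have k_set_int: "set_integrable lborel {0<..} (\<lambda>t. k t + k (- t))"
  proof -
    have "integrable lborel (\<lambda>t. k (- t))"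
      using lborel_integrable_real_affine[OF k_int, of "-1" 0] by simp
    with k_int have "integrable lborel (\<lambda>t. k t + k (- t))"
      by (rule Bochner_Integration.integrable_add)
    then show ?thesis
      unfolding set_integrable_def by (intro integrable_mult_indicator) auto
  qed
  \<comment> \<open>The boundary term: its derivative is the integrand of \<open>sym_pv f' l\<close>
    minus the folded \<open>k\<close>, and both its limits are 0.\<close>
  define P where "P t = (f (l + t) + f (l - t)) / t" for t
  have ein: "einterval 0 \<infinity> = {0::real<..}"
    by (auto simp: einterval_def)
  have "(LBINT t=0..\<infinity>. sym_quot f' l t - (k t + k (- t))) = 0 - 0"
  proof (rule interval_integral_FTC_integrable[where F = P])
    fix t :: real
    assume "0 < ereal t" "ereal t < \<infinity>"
    then have t: "0 < t" by simp
    have "((\<lambda>t. f (l + t)) has_real_derivative f' (l + t)) (at t)"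
      using DERIV_shift[of f "f' (t + l)" t l] f.deriv by (simp add: add.commute)
    moreover have "((\<lambda>t. f (l - t)) has_real_derivative - f' (l - t)) (at t)"
    proof -
      have "((\<lambda>t. l - t) has_real_derivative - 1) (at t)"
        by (auto intro!: derivative_eq_intros)
      from DERIV_chain'[OF this f.deriv] show ?thesis
        by simp
    qed
    ultimately have "(P has_real_derivative
        ((f' (l + t) + - f' (l - t)) * t - (f (l + t) + f (l - t)) * 1) / (t * t)) (at t)"
      unfolding P_def using t by (intro DERIV_divide DERIV_add DERIV_ident) auto
    also have "((f' (l + t) + - f' (l - t)) * t - (f (l + t) + f (l - t)) * 1) / (t * t)
        = sym_quot f' l t - (k t + k (- t))"
      using t by (simp add: sym_quot_def k_def field_simps power2_eq_square)
    finally show "(P has_vector_derivative sym_quot f' l t - (k t + k (- t))) (at t)"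
      by (simp add: has_real_derivative_iff_has_vector_derivative)
    have comp: "isCont (\<lambda>t. p (l + t)) t" "isCont (\<lambda>t. p (l - t)) t" "isCont (\<lambda>t. p (l + - t)) t"
      if "\<And>x. isCont p x" for p :: "real \<Rightarrow> real"
      by (rule isCont_o2[OF _ that], simp)+
    show "isCont (\<lambda>t. sym_quot f' l t - (k t + k (- t))) t"
      unfolding sym_quot_def k_def using t
      by (intro continuous_diff continuous_add continuous_divide comp DERIV_isCont[OF f.deriv]
          DERIV_isCont[OF f'.deriv] continuous_intros) auto
  next
    show "set_integrable lborel (einterval 0 \<infinity>) (\<lambda>t. sym_quot f' l t - (k t + k (- t)))"
      unfolding ein using f'.sym_pv_integrable k_set_int by (rule set_integral_diff)
    have "(P \<longlongrightarrow> 0) (at_right 0)"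
    proof (rule Lim_null_comparison)
      show "\<forall>\<^sub>F t in at_right 0. norm (P t) \<le> 2 * D * t"
        using eventually_at_right_less[of 0]
      proof eventually_elim
        case (elim t)
        have "\<bar>f (l + t) + f (l - t)\<bar> \<le> 2 * D * t * t"
          using quad[of t] quad[of "- t"] by (simp add: power2_eq_square)
        then show ?case
          using elim by (simp add: P_def abs_divide divide_le_eq)
      qed
      show "((\<lambda>t. 2 * D * t) \<longlongrightarrow> 0) (at_right 0)"
        by (auto intro!: tendsto_eq_intros)
    qed
    then show "((P \<circ> real_of_ereal) \<longlongrightarrow> 0) (at_right 0)"
      by (simp add: zero_ereal_def ereal_tendsto_simps)
    have "(P \<longlongrightarrow> 0) at_top"
    proof (rule Lim_null_comparison)
      show "\<forall>\<^sub>F t in at_top. norm (P t) \<le> 2 * C / t"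
        using eventually_gt_at_top[of 0]
      proof eventually_elim
        case (elim t)
        have "\<bar>f (l + t) + f (l - t)\<bar> \<le> 2 * C"
          using f.bound_le[of "l + t"] f.bound_le[of "l - t"] by linarith
        then show ?case
          using elim by (simp add: P_def abs_divide divide_right_mono)
      qed
      show "((\<lambda>t. 2 * C / t) \<longlongrightarrow> 0) at_top"
        by (rule real_tendsto_divide_at_top[OF tendsto_const filterlim_ident])
    qed
    then show "((P \<circ> real_of_ereal) \<longlongrightarrow> 0) (at_left \<infinity>)"
      by (simp add: ereal_tendsto_simps)
  qed auto
  then have "(LINT t:{0<..}|lborel. sym_quot f' l t - (k t + k (- t))) = 0"
    by (simp add: interval_lebesgue_integral_def ein)
  then have "sym_pv f' l = (LINT t:{0<..}|lborel. k t + k (- t))"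
    using set_integral_diff(2)[OF f'.sym_pv_integrable k_set_int] by (simp add: sym_pv_def)
  also have "\<dots> = integral\<^sup>L lborel k"
    using integral_lborel_fold[OF k_int] by simp
  finally show "sym_pv f' l = (\<integral>t. f (l + t) / t\<^sup>2 \<partial>lborel)"
    by (simp add: k_def[abs_def])
qed

section \<open>Schwartz functions\<close>

lemma iter_deriv_has_vector_derivative:
  assumes "u \<in> schwartz_space"
  shows "(iter_deriv n u has_vector_derivative iter_deriv (Suc n) u x) (at x)"
  using assms by (simp add: schwartz_space_def iter_deriv_def vector_derivative_works)

lemma iter_deriv_bound:
  assumes "u \<in> schwartz_space"
  obtains K where "\<And>x. norm (iter_deriv n u x) \<le> K / (1 + x\<^sup>2)"
proof -
  from assms have "bounded (range (\<lambda>x. x ^ k *\<^sub>R iter_deriv n u x))" for k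
    by (simp add: schwartz_space_def)
  \<comment> \<open>The bounds with weights 1 and x^2 add up to one with weight 1 + x^2.\<close>
  from this[of 0] this[of 2] obtain a b where
    "\<And>x. norm (iter_deriv n u x) \<le> a" "\<And>x. x\<^sup>2 * norm (iter_deriv n u x) \<le> b"
    by (auto simp: bounded_iff)
  then have "norm (iter_deriv n u x) * (1 + x\<^sup>2) \<le> a + b" for x
    by (simp add: distrib_left mult.commute add_mono)
  then show ?thesis
    by (intro that[of "a + b"]) (simp add: le_divide_eq add_pos_nonneg)
qed

text \<open>The squared norm is the real inner product of \<open>u\<close> with itself, so the
  product rule expresses both derivatives through inner products of \<open>u\<close> and its first
  two derivatives, each estimated by Cauchy-Schwarz.\<close>

lemma schwartz_norm_square_decaying:
  fixes u :: "real \<Rightarrow> 'a::real_inner"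
  assumes "u \<in> schwartz_space"
  obtains g' g'' C where "decaying (\<lambda>x. (norm (u x))\<^sup>2) g' C" "decaying g' g'' C"
proof -
  define v where "v n = iter_deriv n u" for n
  have v0: "v 0 = u"
    by (simp add: v_def iter_deriv_def)
  have dv: "(v n has_vector_derivative v (Suc n) x) (at x)" for n x
    unfolding v_def using assms by (rule iter_deriv_has_vector_derivative)
  have "\<exists>K. \<forall>x. norm (v n x) \<le> K / (1 + x\<^sup>2)" for n
    using iter_deriv_bound[OF assms, of n] unfolding v_def by metis
  then obtain K where K: "\<And>n x. norm (v n x) \<le> K n / (1 + x\<^sup>2)"
    by metis
  define M where "M = max (K 0) (max (K 1) (K 2))"
  have vM: "norm (v n x) \<le> M / (1 + x\<^sup>2)" if "n \<le> 2" for n x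
  proof -
    have "K n \<le> M"
      using that by (auto simp: M_def le_Suc_eq numeral_2_eq_2)
    then have "K n / (1 + x\<^sup>2) \<le> M / (1 + x\<^sup>2)"
      by (intro divide_right_mono) auto
    with K[of n x] show ?thesis
      by linarith
  qed
  have "0 \<le> M"
    using order_trans[OF norm_ge_zero vM[of 0 0]] by simp
  have div_le: "M / (1 + x\<^sup>2) \<le> M / 1" for x :: real
    using \<open>0 \<le> M\<close> by (intro divide_left_mono) (auto simp: add_pos_nonneg)
  have inner_bound: "\<bar>v m x \<bullet> v n x\<bar> \<le> M\<^sup>2 / (1 + x\<^sup>2)" if "m \<le> 2" "n \<le> 2" for m n x
  proof -
    have "\<bar>v m x \<bullet> v n x\<bar> \<le> norm (v m x) * norm (v n x)"
      by (rule Cauchy_Schwarz_ineq2)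
    also have "\<dots> \<le> M * (M / (1 + x\<^sup>2))"
      using order_trans[OF vM[of m x] div_le[of x]] vM[of n x] that \<open>0 \<le> M\<close> by (intro mult_mono) auto
    finally show ?thesis
      by (simp add: power2_eq_square)
  qed
  have div_le2: "M\<^sup>2 / (1 + x\<^sup>2) \<le> M\<^sup>2" for x :: real
    using divide_left_mono[of 1 "1 + x\<^sup>2" "M\<^sup>2"] by (simp add: add_pos_nonneg)
  have d_inner: "((\<lambda>x. v m x \<bullet> v n x) has_real_derivative v m x \<bullet> v (Suc n) x + v (Suc m) x \<bullet> v n x) (at x)"
    for m n x
    unfolding has_real_derivative_iff_has_vector_derivative
    by (rule bounded_bilinear.has_vector_derivative[OF bounded_bilinear_inner dv dv])
  define g' where "g' x = 2 * (v 0 x \<bullet> v 1 x)" for x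
  define g'' where "g'' x = 2 * (v 0 x \<bullet> v 2 x + v 1 x \<bullet> v 1 x)" for x
  show ?thesis
  proof
    \<comment> \<open>The 4 is what \<open>g''\<close> needs: twice a sum of two inner products,
      each at most \<open>M\<^sup>2\<close>. The same constant then serves both instances.\<close>
    show "decaying (\<lambda>x. (norm (u x))\<^sup>2) g' (4 * M\<^sup>2)"
    proof
      show "((\<lambda>x. (norm (u x))\<^sup>2) has_real_derivative g' x) (at x)" for x
        using d_inner[of 0 0 x]
        by (simp add: g'_def v0 power2_norm_eq_inner inner_commute[of "v (Suc 0) x"])
      show "\<bar>(norm (u x))\<^sup>2\<bar> \<le> 4 * M\<^sup>2 / (1 + x\<^sup>2)" for x
      proof -
        have "0 \<le> M\<^sup>2 / (1 + x\<^sup>2)"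
          by simp
        then show ?thesis
          using inner_bound[of 0 0 x] unfolding v0 power2_norm_eq_inner by linarith
      qed
      show "\<bar>g' x\<bar> \<le> 4 * M\<^sup>2" for x
        using inner_bound[of 0 1 x] div_le2[of x] zero_le_power2[of M]
        unfolding g'_def by linarith
    qed
    show "decaying g' g'' (4 * M\<^sup>2)"
    proof
      show "(g' has_real_derivative g'' x) (at x)" for x
        using DERIV_cmult[OF d_inner[of 0 1 x], of 2]
        by (simp add: g'_def[abs_def] g''_def numeral_2_eq_2)
      show "\<bar>g' x\<bar> \<le> 4 * M\<^sup>2 / (1 + x\<^sup>2)" for x
      proof -
        have "0 \<le> M\<^sup>2 / (1 + x\<^sup>2)"
          by simp
        then show ?thesis
          using inner_bound[of 0 1 x] unfolding g'_def by linarith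
      qed
      show "\<bar>g'' x\<bar> \<le> 4 * M\<^sup>2" for x
      proof -
        have "\<bar>v 0 x \<bullet> v 2 x\<bar> \<le> M\<^sup>2" "\<bar>v 1 x \<bullet> v 1 x\<bar> \<le> M\<^sup>2"
          by (rule order_trans[OF inner_bound div_le2], simp, simp)+
        then show ?thesis
          using abs_triangle_ineq[of "v 0 x \<bullet> v 2 x" "v 1 x \<bullet> v 1 x"]
          unfolding g''_def abs_mult by simp
      qed
    qed
  qed
qed

section \<open>The spectral shift function\<close>

text \<open>Stated on segments because \<open>h\<close> may have either sign or vanish, so the order
  of the two endpoints is not known.\<close>

lemma real_MVT_segment:
  fixes f :: "real \<Rightarrow> real"
  assumes "\<And>x. (f has_real_derivative f' x) (at x)"
  shows "\<exists>z\<in>closed_segment x y. f y - f x = (y - x) * f' z"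
proof -
  consider "x < y" | "x = y" | "y < x"
    by linarith
  then show ?thesis
  proof cases
    case 1
    then show ?thesis
      using MVT2[of x y f f'] assms by (force simp: closed_segment_eq_real_ivl)
  next
    case 2
    then show ?thesis by auto
  next
    case 3
    then obtain z where "y < z" "z < x" "f x - f y = (x - y) * f' z"
      using MVT2[of y x f f'] assms by blast
    then show ?thesis
      using 3 by (intro bexI[of _ z]) (auto simp: closed_segment_eq_real_ivl algebra_simps)
  qed
qed

text \<open>Both endpoints move, so differentiability at \<open>a\<close> would not suffice. The
  mean value theorem rewrites the quotient as \<open>h\<close> times \<open>f'\<close> at an
  intermediate point, and continuity of \<open>f'\<close> at \<open>a\<close> finishes.\<close>

lemma tendsto_increment_quotient:
  fixes f :: "real \<Rightarrow> real"
  assumes f: "\<And>x. (f has_real_derivative f' x) (at x)" and f': "isCont f' a"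
    and p: "(p \<longlongrightarrow> a) G" and q: "((\<lambda>s. p s + h * k s) \<longlongrightarrow> a) G"
    and k: "\<forall>\<^sub>F s in G. k s \<noteq> 0"
  shows "((\<lambda>s. (f (p s + h * k s) - f (p s)) / k s) \<longlongrightarrow> h * f' a) G"
proof -
  obtain Z where Z: "\<And>x y. Z x y \<in> closed_segment x y" "\<And>x y. f y - f x = (y - x) * f' (Z x y)"
    using real_MVT_segment[OF f] by metis
  let ?z = "\<lambda>s. Z (p s) (p s + h * k s)"
  have "((\<lambda>s. ?z s - a) \<longlongrightarrow> 0) G"
  proof (rule Lim_null_comparison)
    show "\<forall>\<^sub>F s in G. norm (?z s - a) \<le> \<bar>p s - a\<bar> + \<bar>p s + h * k s - a\<bar>"
    proof (intro always_eventually allI)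
      fix s
      show "norm (?z s - a) \<le> \<bar>p s - a\<bar> + \<bar>p s + h * k s - a\<bar>"
        using Z(1)[of "p s" "p s + h * k s"]
        by (auto simp: closed_segment_eq_real_ivl split: if_splits)
    qed
    show "((\<lambda>s. \<bar>p s - a\<bar> + \<bar>p s + h * k s - a\<bar>) \<longlongrightarrow> 0) G"
      by (intro tendsto_add_zero tendsto_rabs_zero) (use p q in \<open>auto simp: LIM_zero_iff\<close>)
  qed
  then have "(?z \<longlongrightarrow> a) G"
    by (simp add: LIM_zero_iff)
  then have "((\<lambda>s. h * f' (?z s)) \<longlongrightarrow> h * f' a) G"
    by (intro tendsto_mult_left isCont_tendsto_compose[OF f'])
  then show ?thesis
    by (rule Lim_transform_eventually) (use k in \<open>eventually_elim, simp add: Z(2)\<close>)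
qed

text \<open>A nonzero imaginary part keeps the curve off the branch cut, so \<open>Arg\<close> is
  the imaginary part of \<open>Ln\<close> and its derivative is that of the logarithmic derivative
  z'/z.\<close>

lemma has_real_derivative_Arg:
  assumes a: "(a has_real_derivative a') (at x)" and b: "(b has_real_derivative b') (at x)"
    and "b x \<noteq> 0"
  shows "((\<lambda>x. Arg (of_real (a x) + \<i> * of_real (b x))) has_real_derivative
    (a x * b' - b x * a') / ((a x)\<^sup>2 + (b x)\<^sup>2)) (at x)"
proof -
  let ?z = "\<lambda>x. complex_of_real (a x) + \<i> * complex_of_real (b x)"
  have "(?z has_vector_derivative (of_real a' + \<i> * of_real b')) (at x)"
    using a b
    by (intro has_vector_derivative_add has_vector_derivative_mult_right has_vector_derivative_of_real)
  moreover have "?z x \<notin> \<real>\<^sub>\<le>\<^sub>0"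
    using assms by (auto simp: complex_nonpos_Reals_iff)
  ultimately have "((Ln \<circ> ?z) has_vector_derivative
      (of_real a' + \<i> * of_real b') * inverse (?z x)) (at x)"
    by (intro field_vector_diff_chain_at has_field_derivative_Ln)
  then have "((\<lambda>x. Im (Ln (?z x))) has_real_derivative
      Im ((of_real a' + \<i> * of_real b') * inverse (?z x))) (at x)"
    unfolding has_real_derivative_iff_has_vector_derivative comp_def
    by (rule bounded_linear.has_vector_derivative[OF bounded_linear_Im])
  moreover have "Im ((of_real a' + \<i> * of_real b') * inverse (?z x))
      = (a x * b' - b x * a') / ((a x)\<^sup>2 + (b x)\<^sup>2)"
    by (simp add: diff_divide_distrib mult_ac)
  \<comment> \<open>The identity of \<open>Arg\<close> with \<open>Im (Ln _)\<close> is used for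
    nonzero arguments, so it is needed on a whole neighbourhood; continuity of \<open>b\<close>
    supplies one.\<close>
  moreover have "\<forall>\<^sub>F y in nhds x. Im (Ln (?z y)) = Arg (?z y)"
  proof -
    have "\<forall>\<^sub>F y in at x. b y \<noteq> 0"
      using DERIV_isCont[OF b] \<open>b x \<noteq> 0\<close> unfolding isCont_def by (rule tendsto_imp_eventually_ne)
    with \<open>b x \<noteq> 0\<close> have "\<forall>\<^sub>F y in nhds x. b y \<noteq> 0"
      by (auto simp: eventually_at_filter elim: eventually_mono)
    then show ?thesis
      by eventually_elim (subst Arg_eq_Im_Ln; auto simp: complex_eq_iff)
  qed
  ultimately show ?thesis
    using DERIV_cong_ev[OF refl] by fastforce
qed

text \<open>Translation by \<open>l\<close> and comparison off the null point \<open>t = 0\<close>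
  bring the norm into the form delivered by the integration by parts.\<close>

lemma L2_norm_phi_square:
  assumes [measurable]: "u \<in> borel_measurable borel"
  shows "(L2_norm (phi u l))\<^sup>2 = (\<integral>t. (cmod (u (l + t)))\<^sup>2 / t\<^sup>2 \<partial>lborel)"
proof -
  have "(L2_norm (phi u l))\<^sup>2 = (\<integral>x. (cmod (phi u l x))\<^sup>2 \<partial>lborel)"
    by (simp add: L2_norm_def)
  also have "\<dots> = (\<integral>t. (cmod (phi u l (l + t)))\<^sup>2 \<partial>lborel)"
    by (subst lborel_integral_real_affine[of 1 _ l]) simp_all
  also have "\<dots> = (\<integral>t. (cmod (u (l + t)))\<^sup>2 / t\<^sup>2 \<partial>lborel)"
  proof (rule integral_cong_AE)
    show "AE t in lborel. (cmod (phi u l (l + t)))\<^sup>2 = (cmod (u (l + t)))\<^sup>2 / t\<^sup>2"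
      using AE_lborel_singleton[of 0]
      by eventually_elim (simp add: phi_def norm_divide power_divide)
  qed (auto simp: phi_def[abs_def])
  finally show ?thesis .
qed

text \<open>A vanishing integral would force \<open>k = 0\<close> almost everywhere, making the
  whole line a null set.\<close>

lemma integral_lborel_pos:
  fixes k :: "real \<Rightarrow> real"
  assumes "integrable lborel k" "AE t in lborel. 0 < k t"
  shows "0 < integral\<^sup>L lborel k"
proof -
  have "integral\<^sup>L lborel k \<noteq> 0"
  proof
    assume "integral\<^sup>L lborel k = 0"
    moreover have "AE t in lborel. 0 \<le> k t"
      using assms(2) by eventually_elim simp
    ultimately have "AE t in lborel. k t = 0"
      using integral_nonneg_eq_0_iff_AE[OF assms(1)] by blast
    with assms(2) have "AE t::real in lborel. False"
      by eventually_elim simp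
    then show False
      by (subst (asm) AE_iff_null) (auto simp: null_sets_def)
  qed
  moreover have "0 \<le> integral\<^sup>L lborel k"
    using assms(2) by (intro integral_nonneg_AE) (auto elim: eventually_mono)
  ultimately show ?thesis
    by linarith
qed

text \<open>The first conjunct ensures that \<open>deriv\<close> in the limit is a genuine
  derivative and not an unspecified value.\<close>

theorem theorem6p2:
  fixes \<alpha>\<^sub>0 l\<^sub>0 h :: real
    and u :: "real \<Rightarrow> complex"
    and J :: "real set"
    and lam :: "real \<Rightarrow> real"
  assumes "u \<in> schwartz_space"
    and "L2_norm u = 1"
    and "\<And>x. u x = 0 \<longleftrightarrow> x = l\<^sub>0"
    and "1 + \<alpha>\<^sub>0 * pv_integral (\<lambda>x. (cmod (u x))\<^sup>2) l\<^sub>0 = 0"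
    and "open J" and "is_interval J" and "\<alpha>\<^sub>0 \<in> J"
    and "lam C1_differentiable_on J"
    and "lam \<alpha>\<^sub>0 = l\<^sub>0"
    and "\<And>\<alpha>. \<alpha> \<in> J \<Longrightarrow> F1 u \<alpha> (lam \<alpha>) = 0"
  shows "(\<forall>\<^sub>F \<alpha> in at \<alpha>\<^sub>0. xi u \<alpha> field_differentiable at (lam_shift u l\<^sub>0 lam h \<alpha>)) \<and>
         ((\<lambda>\<alpha>. kappa u l\<^sub>0 lam \<alpha> * deriv (xi u \<alpha>) (lam_shift u l\<^sub>0 lam h \<alpha>))
            \<longlongrightarrow> - (1 / (pi * (h\<^sup>2 + 1)))) (at \<alpha>\<^sub>0)"
proof -

  \<comment> \<open>The squared modulus and its double zero\<close>
  define g where "g x = (cmod (u x))\<^sup>2" for x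
  obtain g' g'' C where dec: "decaying g g' C" and dec': "decaying g' g'' C"
    using schwartz_norm_square_decaying[OF assms(1)] unfolding g_def by metis
  interpret g: decaying g g' C by fact
  interpret g': decaying g' g'' C by fact
  note g_cont = DERIV_isCont[OF g.deriv] and g'_cont = DERIV_isCont[OF g'.deriv]
  have g_l0: "g l\<^sub>0 = 0" and g_pos: "x \<noteq> l\<^sub>0 \<Longrightarrow> 0 < g x" for x
    using assms(3) by (auto simp: g_def)
  have g'_l0: "g' l\<^sub>0 = 0"
    using g_l0 by (intro DERIV_local_min[OF g.deriv zero_less_one]) (auto simp: g_def)

  \<comment> \<open>The principal value as a C^1 function\<close>
  define \<gamma> where "\<gamma> = sym_pv g"
  define \<gamma>' where "\<gamma>' = sym_pv g'"
  have d\<gamma>: "(\<gamma> has_real_derivative \<gamma>' x) (at x)" for x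
    unfolding \<gamma>_def \<gamma>'_def using dec dec' by (rule has_real_derivative_sym_pv)
  have \<gamma>'_cont: "isCont \<gamma>' x" for x
    unfolding isCont_def \<gamma>'_def by (rule g'.sym_pv_tendsto)
  have pv: "pv_integral (\<lambda>x. (cmod (u x))\<^sup>2) = \<gamma>"
    using g.pv_integral_eq_sym_pv by (auto simp: \<gamma>_def g_def[abs_def])
  have F1: "F1 u \<alpha> x = 1 + \<alpha> * \<gamma> x" and F2: "F2 u \<alpha> x = \<alpha> * pi * g x" for \<alpha> x
    by (simp_all add: F1_def F2_def pv g_def)
  have \<gamma>_l0: "1 + \<alpha>\<^sub>0 * \<gamma> l\<^sub>0 = 0"
    using assms(4) by (simp add: pv)
  then have "\<alpha>\<^sub>0 \<noteq> 0"
    by auto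

  \<comment> \<open>The slope at the zero and the norm of \<open>phi\<close>\<close>
  define N where "N = \<gamma>' l\<^sub>0"
  have N_eq: "N = (\<integral>t. g (l\<^sub>0 + t) / t\<^sup>2 \<partial>lborel)"
    unfolding N_def \<gamma>'_def by (rule sym_pv_deriv_double_zero[OF dec dec' g_l0 g'_l0])
  have "0 < N"
    unfolding N_eq
  proof (rule integral_lborel_pos)
    show "AE t in lborel. 0 < g (l\<^sub>0 + t) / t\<^sup>2"
      using AE_lborel_singleton[of 0] by eventually_elim (simp add: g_pos)
  qed (rule sym_pv_deriv_double_zero[OF dec dec' g_l0 g'_l0])
  have L2_phi: "(L2_norm (phi u l\<^sub>0))\<^sup>2 = N"
  proof -
    have "isCont u x" for x
      using iter_deriv_has_vector_derivative[OF assms(1), of 0]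
      by (auto simp: iter_deriv_def dest: has_vector_derivative_continuous)
    then have "u \<in> borel_measurable borel"
      by (intro borel_measurable_continuous_onI continuous_at_imp_continuous_on) auto
    then show ?thesis
      by (simp add: L2_norm_phi_square N_eq g_def)
  qed

  \<comment> \<open>The curve of zeros and the shifted point\<close>
  define \<kappa> where "\<kappa> = kappa u l\<^sub>0 lam"
  define s where "s = lam_shift u l\<^sub>0 lam h"
  have \<kappa>_eq: "\<kappa> \<alpha> = pi * g (lam \<alpha>) / N" and s_eq: "s \<alpha> = lam \<alpha> + h * \<kappa> \<alpha>" for \<alpha>
    by (simp_all add: \<kappa>_def s_def kappa_def lam_shift_def L2_phi g_def)
  have lam: "(lam \<longlongrightarrow> l\<^sub>0) (at \<alpha>\<^sub>0)"
  proof -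
    obtain D where "(lam has_vector_derivative D) (at \<alpha>\<^sub>0)"
      using assms(7,8) by (auto simp: C1_differentiable_on_def)
    then have "isCont lam \<alpha>\<^sub>0"
      by (rule has_vector_derivative_continuous)
    then show ?thesis
      using assms(9) by (simp add: isCont_def)
  qed
  have near: "\<forall>\<^sub>F \<alpha> in at \<alpha>\<^sub>0. 1 + \<alpha> * \<gamma> (lam \<alpha>) = 0 \<and> 0 < \<kappa> \<alpha>"
    using eventually_at_in_open[OF assms(5,7)]
  proof eventually_elim
    case (elim \<alpha>)
    then have zero: "1 + \<alpha> * \<gamma> (lam \<alpha>) = 0"
      using assms(10) by (simp add: F1)
    \<comment> \<open>If the curve returned to the zero of \<open>u\<close>, subtracting the
      equations for \<alpha> and \<open>\<alpha>\<^sub>0\<close> would give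
      \<open>\<alpha> = \<alpha>\<^sub>0\<close>, since \<gamma> is nonzero there. Hence \<kappa> is
      positive off \<open>\<alpha>\<^sub>0\<close>.\<close>
    have "lam \<alpha> \<noteq> l\<^sub>0"
    proof
      assume "lam \<alpha> = l\<^sub>0"
      with zero \<gamma>_l0 have "(\<alpha> - \<alpha>\<^sub>0) * \<gamma> l\<^sub>0 = 0"
        by (simp add: left_diff_distrib add_eq_0_iff)
      with elim \<gamma>_l0 show False
        by auto
    qed
    with zero show ?case
      using g_pos \<open>0 < N\<close> by (simp add: \<kappa>_eq)
  qed
  then have \<kappa>_nz: "\<forall>\<^sub>F \<alpha> in at \<alpha>\<^sub>0. \<kappa> \<alpha> \<noteq> 0"
    by (auto elim: eventually_mono)
  have "(\<kappa> \<longlongrightarrow> pi * g l\<^sub>0 / N) (at \<alpha>\<^sub>0)"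
    unfolding \<kappa>_eq[abs_def] using \<open>0 < N\<close>
    by (intro tendsto_intros isCont_tendsto_compose[OF g_cont] lam) auto
  then have "(\<kappa> \<longlongrightarrow> 0) (at \<alpha>\<^sub>0)"
    by (simp add: g_l0)
  then have s: "(s \<longlongrightarrow> l\<^sub>0) (at \<alpha>\<^sub>0)"
    unfolding s_eq[abs_def] using lam by (auto intro!: tendsto_eq_intros)

  text \<open>
    Both components of \<open>F\<close> at the shifted point vanish to first order in \<open>\<kappa>\<close>; \<open>A\<close> and \<open>B\<close> are
    their rescalings.
  \<close>
  define A where "A \<alpha> = F1 u \<alpha> (s \<alpha>) / \<kappa> \<alpha>" for \<alpha>
  define B where "B \<alpha> = F2 u \<alpha> (s \<alpha>) / \<kappa> \<alpha>" for \<alpha>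
  have quot: "((\<lambda>\<alpha>. (f (s \<alpha>) - f (lam \<alpha>)) / \<kappa> \<alpha>) \<longlongrightarrow> h * f' l\<^sub>0) (at \<alpha>\<^sub>0)"
    if "\<And>x. (f has_real_derivative f' x) (at x)" "isCont f' l\<^sub>0" for f f'
    using tendsto_increment_quotient[OF that lam s[unfolded s_eq[abs_def]] \<kappa>_nz] by (simp add: s_eq)
  \<comment> \<open>\<open>F1\<close> vanishes on the curve, so its value at the shifted point is
    \<alpha> times the increment of \<gamma>.\<close>
  have "((\<lambda>\<alpha>. \<alpha> * ((\<gamma> (s \<alpha>) - \<gamma> (lam \<alpha>)) / \<kappa> \<alpha>)) \<longlongrightarrow> \<alpha>\<^sub>0 * (h * N)) (at \<alpha>\<^sub>0)"
    unfolding N_def by (intro tendsto_mult tendsto_ident_at quot d\<gamma> \<gamma>'_cont)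
  then have A: "(A \<longlongrightarrow> \<alpha>\<^sub>0 * (h * N)) (at \<alpha>\<^sub>0)"
  proof (rule Lim_transform_eventually)
    show "\<forall>\<^sub>F \<alpha> in at \<alpha>\<^sub>0. \<alpha> * ((\<gamma> (s \<alpha>) - \<gamma> (lam \<alpha>)) / \<kappa> \<alpha>) = A \<alpha>"
      using near
    proof eventually_elim
      case (elim \<alpha>)
      then have "\<alpha> * \<gamma> (lam \<alpha>) = - 1"
        by simp
      then show ?case
        by (simp add: A_def F1 right_diff_distrib)
    qed
  qed
  \<comment> \<open>By the choice of \<kappa>,
    \<open>pi * g (lam \<alpha>) / \<kappa> \<alpha>\<close> is exactly \<open>N\<close>; the
    increment of \<open>g\<close> contributes nothing in the limit because \<open>g'\<close>
    vanishes at the zero of \<open>u\<close>.\<close>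
  have "((\<lambda>\<alpha>. \<alpha> * (N + pi * ((g (s \<alpha>) - g (lam \<alpha>)) / \<kappa> \<alpha>)))
      \<longlongrightarrow> \<alpha>\<^sub>0 * (N + pi * (h * g' l\<^sub>0))) (at \<alpha>\<^sub>0)"
    by (intro tendsto_mult tendsto_add tendsto_const tendsto_ident_at quot g.deriv g'_cont)
  then have B: "(B \<longlongrightarrow> \<alpha>\<^sub>0 * N) (at \<alpha>\<^sub>0)"
    unfolding g'_l0 mult_zero_right add_0_right
  proof (rule Lim_transform_eventually)
    show "\<forall>\<^sub>F \<alpha> in at \<alpha>\<^sub>0. \<alpha> * (N + pi * ((g (s \<alpha>) - g (lam \<alpha>)) / \<kappa> \<alpha>)) = B \<alpha>"
      using near
    proof eventually_elim
      case (elim \<alpha>)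
      then have "N = pi * g (lam \<alpha>) / \<kappa> \<alpha>"
        using \<open>0 < N\<close> by (auto simp: \<kappa>_eq)
      then have "N + pi * ((g (s \<alpha>) - g (lam \<alpha>)) / \<kappa> \<alpha>) = pi * g (s \<alpha>) / \<kappa> \<alpha>"
        by (simp add: right_diff_distrib diff_divide_distrib)
      then show ?case
        by (simp add: B_def F2)
    qed
  qed

  \<comment> \<open>Derivative of the spectral shift function and its limit\<close>
  have "\<alpha>\<^sub>0 * N \<noteq> 0"
    using \<open>\<alpha>\<^sub>0 \<noteq> 0\<close> \<open>0 < N\<close> by simp
  have d_xi: "\<forall>\<^sub>F \<alpha> in at \<alpha>\<^sub>0. (xi u \<alpha> has_real_derivative
      (F1 u \<alpha> (s \<alpha>) * (\<alpha> * pi * g' (s \<alpha>)) - F2 u \<alpha> (s \<alpha>) * (\<alpha> * \<gamma>' (s \<alpha>)))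
        / ((F1 u \<alpha> (s \<alpha>))\<^sup>2 + (F2 u \<alpha> (s \<alpha>))\<^sup>2) / pi) (at (s \<alpha>))"
    \<comment> \<open>The nonzero limit of \<open>B\<close> forces \<open>F2\<close> to be nonzero
      at the shifted point, so the derivative formula for \<open>Arg\<close> applies.\<close>
    using tendsto_imp_eventually_ne[OF B \<open>\<alpha>\<^sub>0 * N \<noteq> 0\<close>]
  proof eventually_elim
    case (elim \<alpha>)
    then have "F2 u \<alpha> (s \<alpha>) \<noteq> 0"
      by (auto simp: B_def)
    moreover have "(F1 u \<alpha> has_real_derivative \<alpha> * \<gamma>' (s \<alpha>)) (at (s \<alpha>))"
      unfolding F1[abs_def] using d\<gamma> by (auto intro!: derivative_eq_intros)
    moreover have "(F2 u \<alpha> has_real_derivative \<alpha> * pi * g' (s \<alpha>)) (at (s \<alpha>))"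
      unfolding F2[abs_def] using g.deriv by (intro DERIV_cmult)
    ultimately show ?case
      unfolding xi_def[abs_def] F_def by (intro DERIV_cdivide has_real_derivative_Arg)
  qed
  then have "\<forall>\<^sub>F \<alpha> in at \<alpha>\<^sub>0. xi u \<alpha> field_differentiable at (s \<alpha>)"
    by (auto simp: field_differentiable_def elim: eventually_mono)
  moreover have "((\<lambda>\<alpha>. \<kappa> \<alpha> * deriv (xi u \<alpha>) (s \<alpha>)) \<longlongrightarrow> - (1 / (pi * (h\<^sup>2 + 1)))) (at \<alpha>\<^sub>0)"
  proof (rule Lim_transform_eventually)
    have "((\<lambda>\<alpha>. (A \<alpha> * (\<alpha> * pi * g' (s \<alpha>)) - B \<alpha> * (\<alpha> * \<gamma>' (s \<alpha>))) / ((A \<alpha>)\<^sup>2 + (B \<alpha>)\<^sup>2) / pi)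
        \<longlongrightarrow> (\<alpha>\<^sub>0 * (h * N) * (\<alpha>\<^sub>0 * pi * g' l\<^sub>0) - \<alpha>\<^sub>0 * N * (\<alpha>\<^sub>0 * \<gamma>' l\<^sub>0))
          / ((\<alpha>\<^sub>0 * (h * N))\<^sup>2 + (\<alpha>\<^sub>0 * N)\<^sup>2) / pi) (at \<alpha>\<^sub>0)"
      using \<open>\<alpha>\<^sub>0 * N \<noteq> 0\<close>
      by (intro tendsto_intros A B isCont_tendsto_compose[OF g'_cont s]
          isCont_tendsto_compose[OF \<gamma>'_cont s]) (auto simp: sum_power2_eq_zero_iff)
    also have "(\<alpha>\<^sub>0 * (h * N) * (\<alpha>\<^sub>0 * pi * g' l\<^sub>0) - \<alpha>\<^sub>0 * N * (\<alpha>\<^sub>0 * \<gamma>' l\<^sub>0))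
          / ((\<alpha>\<^sub>0 * (h * N))\<^sup>2 + (\<alpha>\<^sub>0 * N)\<^sup>2) / pi
        = - ((\<alpha>\<^sub>0 * N)\<^sup>2 / ((\<alpha>\<^sub>0 * N)\<^sup>2 * (pi * (h\<^sup>2 + 1))))"
      unfolding g'_l0 N_def[symmetric]
      by (simp add: power2_eq_square algebra_simps)
    also have "\<dots> = - (1 / (pi * (h\<^sup>2 + 1)))"
      using \<open>\<alpha>\<^sub>0 * N \<noteq> 0\<close> by simp
    finally show "((\<lambda>\<alpha>. (A \<alpha> * (\<alpha> * pi * g' (s \<alpha>)) - B \<alpha> * (\<alpha> * \<gamma>' (s \<alpha>)))
        / ((A \<alpha>)\<^sup>2 + (B \<alpha>)\<^sup>2) / pi) \<longlongrightarrow> - (1 / (pi * (h\<^sup>2 + 1)))) (at \<alpha>\<^sub>0)" .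
    \<comment> \<open>The numerator is linear and the denominator quadratic in the pair
      \<open>a\<close>, \<open>b\<close>, so dividing both by \<open>k\<close> produces one factor
      \<open>k\<close>: exactly the prefactor \<kappa> in the claimed limit.\<close>
    have rescale: "(a / k * x - b / k * y) / ((a / k)\<^sup>2 + (b / k)\<^sup>2)
        = k * ((a * x - b * y) / (a\<^sup>2 + b\<^sup>2))" if "k \<noteq> 0" for a b k x y :: real
    proof -
      have "(a / k)\<^sup>2 + (b / k)\<^sup>2 = (a\<^sup>2 + b\<^sup>2) / (k * k)"
        by (simp add: power_divide add_divide_distrib power2_eq_square)
      moreover have "a / k * x - b / k * y = (a * x - b * y) / k"
        by (simp add: diff_divide_distrib)
      ultimately show ?thesis
        using that by simp
    qed
    show "\<forall>\<^sub>F \<alpha> in at \<alpha>\<^sub>0. (A \<alpha> * (\<alpha> * pi * g' (s \<alpha>)) - B \<alpha> * (\<alpha> * \<gamma>' (s \<alpha>)))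
        / ((A \<alpha>)\<^sup>2 + (B \<alpha>)\<^sup>2) / pi = \<kappa> \<alpha> * deriv (xi u \<alpha>) (s \<alpha>)"
      using d_xi \<kappa>_nz
    proof eventually_elim
      case (elim \<alpha>)
      show ?case
        unfolding A_def B_def rescale[OF elim(2)] DERIV_imp_deriv[OF elim(1)] by simp
    qed
  qed
  ultimately show ?thesis
    by (simp add: \<kappa>_def s_def)
qed

end
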